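(* Let $a,b>0$ and consider the homothetic pair of ellipses $\mathcal{E}:\ \frac{x^2}{a^2}+\frac{y^2}{b^2}=1$ and $\mathcal{E}':\ \frac{x^2}{(a/2)^2}+\frac{y^2}{(b/2)^2}=1$. All triangles inscribed in $\mathcal{E}$ and circumscribed about $\mathcal{E}'$ (the 3-periodics of the pair) have the same Brocard angle $\omega$, and it is given by $$\cot\omega=\frac{\sqrt{3}\,(a^2+b^2)}{2ab}.$$
   Context: A triangle is inscribed in $\mathcal{E}$ and circumscribed about $\mathcal{E}'$ if its vertices lie on $\mathcal{E}$ and its three sides are tangent to $\mathcal{E}'$; such triangles form a one-parameter (Poncelet) family, called the 3-periodics of the homothetic pair. The Brocard angle $\omega$ of a triangle $P_1P_2P_3$ is the unique angle for which there is a point $\Omega_1$ with $\angle\Omega_1P_1P_2=\angle\Omega_1P_2P_3=\angle\Omega_1P_3P_1=\omega$. *)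

theory Defs
  imports "HOL-Analysis.Analysis"
begin

definition ellipse_form :: "real \<Rightarrow> real \<Rightarrow> real^2 \<Rightarrow> real" where
  "ellipse_form a b P = (P $ 1)\<^sup>2 / a\<^sup>2 + (P $ 2)\<^sup>2 / b\<^sup>2"

definition ellipse :: "real \<Rightarrow> real \<Rightarrow> (real^2) set" where
  "ellipse a b = {P. ellipse_form a b P = 1}"

(* The tangent line at a point Q of the level curve: all Q + v with v in the kernel of the
   derivative at Q of the defining function. *)
definition ellipse_tangent_line :: "real \<Rightarrow> real \<Rightarrow> real^2 \<Rightarrow> (real^2) set" where
  "ellipse_tangent_line a b Q = {P. frechet_derivative (ellipse_form a b) (at Q) (P - Q) = 0}"

definition tangent_to_ellipse :: "real \<Rightarrow> real \<Rightarrow> (real^2) set \<Rightarrow> bool" where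
  "tangent_to_ellipse a b L \<longleftrightarrow> (\<exists>Q \<in> ellipse a b. L = ellipse_tangent_line a b Q)"

definition triangle :: "real^2 \<Rightarrow> real^2 \<Rightarrow> real^2 \<Rightarrow> bool" where
  "triangle P1 P2 P3 \<longleftrightarrow> \<not> collinear {P1, P2, P3}"

definition inscribed_in_ellipse :: "real \<Rightarrow> real \<Rightarrow> real^2 \<Rightarrow> real^2 \<Rightarrow> real^2 \<Rightarrow> bool" where
  "inscribed_in_ellipse a b P1 P2 P3 \<longleftrightarrow> {P1, P2, P3} \<subseteq> ellipse a b"

(* The line through two distinct points is their affine hull. *)
definition circumscribed_about_ellipse :: "real \<Rightarrow> real \<Rightarrow> real^2 \<Rightarrow> real^2 \<Rightarrow> real^2 \<Rightarrow> bool" where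
  "circumscribed_about_ellipse a b P1 P2 P3 \<longleftrightarrow>
     tangent_to_ellipse a b (affine hull {P1, P2}) \<and>
     tangent_to_ellipse a b (affine hull {P2, P3}) \<and>
     tangent_to_ellipse a b (affine hull {P3, P1})"

definition homothetic_3_periodic :: "real \<Rightarrow> real \<Rightarrow> real^2 \<Rightarrow> real^2 \<Rightarrow> real^2 \<Rightarrow> bool" where
  "homothetic_3_periodic a b P1 P2 P3 \<longleftrightarrow>
     triangle P1 P2 P3 \<and>
     inscribed_in_ellipse a b P1 P2 P3 \<and>
     circumscribed_about_ellipse (a / 2) (b / 2) P1 P2 P3"

(* The unoriented angle at B, between 0 and pi; meaningful for A and C different from B. *)
definition angle :: "real^2 \<Rightarrow> real^2 \<Rightarrow> real^2 \<Rightarrow> real" where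
  "angle A B C = arccos (((A - B) \<bullet> (C - B)) / (norm (A - B) * norm (C - B)))"

(* The point W is required to lie inside the triangle: since the angles are unoriented, points
   outside the triangle can also satisfy the three equations, with other values of w, so that
   the Brocard angle would not be unique. *)
definition is_brocard_angle :: "real^2 \<Rightarrow> real^2 \<Rightarrow> real^2 \<Rightarrow> real \<Rightarrow> bool" where
  "is_brocard_angle P1 P2 P3 w \<longleftrightarrow>
     (\<exists>W \<in> interior (convex hull {P1, P2, P3}).
        angle W P1 P2 = w \<and> angle W P2 P3 = w \<and> angle W P3 P1 = w)"

definition brocard_angle :: "real^2 \<Rightarrow> real^2 \<Rightarrow> real^2 \<Rightarrow> real" where
  "brocard_angle P1 P2 P3 = (THE w. is_brocard_angle P1 P2 P3 w)"

end

theory Submission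
  imports Defs
begin

text \<open>
  The affine map \<open>(x, y) \<mapsto> (x / a, y / b)\<close> turns the outer ellipse into the unit circle and the
  inner one into the concentric circle of radius \<open>1/2\<close>.  A chord of the unit circle
  tangent to the small circle subtends an angle of \<open>2\<pi>/3\<close> at the centre, so every 3-periodic is the affine image of an
  equilateral triangle inscribed in the unit circle.

  On the other side, the Brocard angle of any triangle satisfies
  \<open>cot \<omega> = (sum of the squared side lengths) / (4 \<sqdot> area)\<close> (lemma \<open>is_brocard_angle_iff\<close>).
  The cotangent of an angle at a vertex is a scalar product divided by a cross product.  If \<open>W\<close> has
  barycentric coordinates \<open>(x, y, z)\<close>, the absolute values of the three cross products are
  \<open>z\<close>, \<open>x\<close>, \<open>y\<close> times twice the area.  They add up to twice the area,
  while the three scalar products add up to half the sum of the squared sides; so equal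
  cotangents must have the stated value.  Conversely, equality of the
  three cotangents becomes a proportion between \<open>x\<close>, \<open>y\<close> and \<open>z\<close>, and its solution is the Brocard
  point.

  Both quantities in this formula are constant over the family.  The area is \<open>ab\<close> times the area
  \<open>3 \<sqdot> sqrt 3 / 4\<close> of the equilateral triangle.  The squared side lengths add up to
  \<open>a\<^sup>2 X + b\<^sup>2 Y\<close>, where \<open>X\<close> and \<open>Y\<close> are the sums of the squared coordinate differences of the
  equilateral triangle; by its symmetry, \<open>X = Y = 9/2\<close> however the triangle is rotated.
\<close>

section \<open>Angles and the planar cross product\<close>

definition cross2 :: "real^2 \<Rightarrow> real^2 \<Rightarrow> real" where
  "cross2 u v = u $ 1 * v $ 2 - u $ 2 * v $ 1"

lemma lagrange_identity: "(u \<bullet> v)\<^sup>2 + (cross2 u v)\<^sup>2 = (norm u * norm v)\<^sup>2"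
  unfolding power_mult_distrib power2_norm_eq_inner
  by (simp add: cross2_def inner_vec_def sum_2 algebra_simps power2_eq_square)

text \<open>
  A zero cross product is the equality case of the Cauchy--Schwarz inequality.
\<close>

lemma cross2_nonzero_if_triangle:
  assumes "triangle P1 P2 P3"
  shows "cross2 (P2 - P1) (P3 - P1) \<noteq> 0"
proof
  assume "cross2 (P2 - P1) (P3 - P1) = 0"
  then have "\<bar>(P2 - P1) \<bullet> (P3 - P1)\<bar>\<^sup>2 = (norm (P2 - P1) * norm (P3 - P1))\<^sup>2"
    unfolding lagrange_identity[of "P2 - P1" "P3 - P1", symmetric]
    by (simp only: power2_abs power_zero_numeral add_0_right)
  then have "\<bar>(P2 - P1) \<bullet> (P3 - P1)\<bar> = norm (P2 - P1) * norm (P3 - P1)"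
    by (rule power2_eq_imp_eq) (intro abs_ge_zero mult_nonneg_nonneg norm_ge_zero)+
  then have "collinear {0, P2 - P1, P3 - P1}"
    by (simp only: norm_cauchy_schwarz_equal)
  then have "collinear {P2, P1, P3}"
    by (subst collinear_3) (simp_all only: NO_MATCH_def)
  moreover have "{P2, P1, P3} = {P1, P2, P3}" by (rule insert_commute)
  ultimately show False
    using assms by (simp only: triangle_def simp_thms)
qed

text \<open>
  The branch of the inverse cotangent with values strictly between \<open>0\<close> and \<open>\<pi>\<close>, where angles of
  triangles lie; it is written with the arc cosine because angles are.
\<close>

definition arccot :: "real \<Rightarrow> real" where
  "arccot k = arccos (k / sqrt (1 + k\<^sup>2))"

lemma cot_arccot: "cot (arccot k) = k"
proof -
  define s where "s = sqrt (1 + k\<^sup>2)"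
  have s2: "s\<^sup>2 = 1 + k\<^sup>2" unfolding s_def by (rule real_sqrt_pow2) simp
  have s: "s > 0" unfolding s_def by (simp add: add_pos_nonneg)
  have "\<bar>k\<bar> \<le> s" unfolding s_def by (rule real_le_rsqrt) simp
  then have bound: "\<bar>k / s\<bar> \<le> 1"
    using s by (simp add: abs_divide)
  have "(1 / s)\<^sup>2 + (k / s)\<^sup>2 = s\<^sup>2 / s\<^sup>2"
    unfolding power_divide add_divide_distrib[symmetric] s2 by simp
  then have "1 - (k / s)\<^sup>2 = (1 / s)\<^sup>2"
    using s by simp
  then have "sin (arccos (k / s)) = 1 / s"
    using s sin_arccos_abs[OF bound] by (simp add: real_sqrt_divide)
  then show ?thesis
    using s cos_arccos_abs[OF bound] by (simp add: cot_def arccot_def flip: s_def)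
qed

text \<open>
  Unlike the cosine, the cotangent of an angle involves no square roots, and both its numerator
  and, up to the sign, its denominator are affine functions of the point \<open>A\<close>.  This makes the
  three equations for the Brocard point, for a given cotangent, linear in its barycentric
  coordinates.
\<close>

lemma angle_eq_arccot:
  assumes "cross2 (A - B) (C - B) \<noteq> 0"
  shows "angle A B C = arccot (((A - B) \<bullet> (C - B)) / \<bar>cross2 (A - B) (C - B)\<bar>)"
proof -
  define d where "d = (A - B) \<bullet> (C - B)"
  define c where "c = \<bar>cross2 (A - B) (C - B)\<bar>"
  have c: "c > 0" using assms by (simp add: c_def)
  have "norm (A - B) * norm (C - B) = sqrt (d\<^sup>2 + c\<^sup>2)"
    using lagrange_identity[of "A - B" "C - B"] by (simp add: d_def c_def)
  also have "d\<^sup>2 + c\<^sup>2 = c\<^sup>2 * (1 + (d / c)\<^sup>2)"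
    using c by (simp add: field_simps)
  also have "sqrt \<dots> = c * sqrt (1 + (d / c)\<^sup>2)"
    using c by (simp add: real_sqrt_mult)
  finally show ?thesis
    by (simp add: angle_def arccot_def flip: d_def c_def)
qed

section \<open>The Brocard angle of a triangle\<close>

text \<open>
  The denominator is four times the area, since the cross product is twice the signed area.
\<close>

definition brocard_cot :: "real^2 \<Rightarrow> real^2 \<Rightarrow> real^2 \<Rightarrow> real" where
  "brocard_cot P1 P2 P3 =
     ((norm (P1 - P2))\<^sup>2 + (norm (P2 - P3))\<^sup>2 + (norm (P3 - P1))\<^sup>2)
       / (2 * \<bar>cross2 (P2 - P1) (P3 - P1)\<bar>)"

text \<open>
  From \<open>W - A = y (B - A) + z (C - A)\<close>: the cross product with \<open>B - A\<close> only sees \<open>z\<close>, and the scalar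
  product reduces to side lengths by the law of cosines.
\<close>

lemma angle_barycentric:
  assumes D: "cross2 (B - A) (C - A) \<noteq> 0"
    and sum: "x + y + z = 1" and z: "z > 0"
    and W: "W = x *\<^sub>R A + y *\<^sub>R B + z *\<^sub>R C"
  shows "angle W A B =
    arccot ((y * (norm (A - B))\<^sup>2
        + z * ((norm (A - B))\<^sup>2 + (norm (C - A))\<^sup>2 - (norm (B - C))\<^sup>2) / 2)
      / (z * \<bar>cross2 (B - A) (C - A)\<bar>))"
proof -
  have x: "x = 1 - y - z" using sum by simp
  have WA: "W - A = y *\<^sub>R (B - A) + z *\<^sub>R (C - A)"
    unfolding W x by (simp add: algebra_simps)
  have cross: "cross2 (W - A) (B - A) = - z * cross2 (B - A) (C - A)"
    unfolding WA by (simp add: cross2_def algebra_simps)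
  have "(C - A) \<bullet> (B - A)
      = ((norm (A - B))\<^sup>2 + (norm (C - A))\<^sup>2 - (norm (B - C))\<^sup>2) / 2"
    unfolding power2_norm_eq_inner by (simp add: inner_diff inner_commute)
  moreover have "(B - A) \<bullet> (B - A) = (norm (A - B))\<^sup>2"
    by (simp add: power2_norm_eq_inner inner_diff inner_commute)
  ultimately have "(W - A) \<bullet> (B - A) = y * (norm (A - B))\<^sup>2
        + z * ((norm (A - B))\<^sup>2 + (norm (C - A))\<^sup>2 - (norm (B - C))\<^sup>2) / 2"
    unfolding WA by (simp add: inner_add_left)
  moreover have "\<bar>cross2 (W - A) (B - A)\<bar> = z * \<bar>cross2 (B - A) (C - A)\<bar>"
    using z by (simp add: cross abs_mult)
  moreover have "cross2 (W - A) (B - A) \<noteq> 0"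
    using D z by (simp add: cross)
  ultimately show ?thesis
    by (simp add: angle_eq_arccot)
qed

text \<open>
  Adding the three cotangent equations eliminates the point \<open>W\<close>, so at most one angle is possible.
  With that value of the cotangent, the equations reduce to \<open>y d12 = z d23 = x d31\<close>, which
  determines \<open>W\<close>; its coordinates are positive, so \<open>W\<close> is inside the triangle.
\<close>

lemma is_brocard_angle_iff:
  assumes tri: "triangle P1 P2 P3"
  shows "is_brocard_angle P1 P2 P3 w \<longleftrightarrow> w = arccot (brocard_cot P1 P2 P3)"
proof -
  define d12 where "d12 = (norm (P1 - P2))\<^sup>2"
  define d23 where "d23 = (norm (P2 - P3))\<^sup>2"
  define d31 where "d31 = (norm (P3 - P1))\<^sup>2"
  define D where "D = \<bar>cross2 (P2 - P1) (P3 - P1)\<bar>"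
  have D: "D > 0" using cross2_nonzero_if_triangle[OF tri] by (simp add: D_def)
  have rot2: "cross2 (P3 - P2) (P1 - P2) = cross2 (P2 - P1) (P3 - P1)"
    and rot3: "cross2 (P1 - P3) (P2 - P3) = cross2 (P2 - P1) (P3 - P1)"
    by (simp_all add: cross2_def algebra_simps)
  have cot: "brocard_cot P1 P2 P3 = (d12 + d23 + d31) / (2 * D)"
    by (simp add: brocard_cot_def d12_def d23_def d31_def D_def)
  have interior: "interior (convex hull {P1, P2, P3}) =
      {v. \<exists>x y z. 0 < x \<and> 0 < y \<and> 0 < z \<and> x + y + z = 1 \<and>
        x *\<^sub>R P1 + y *\<^sub>R P2 + z *\<^sub>R P3 = v}"
    using tri by (intro interior_convex_hull_3_minimal) (auto simp: triangle_def)
  have angles: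
    "angle W P1 P2 = arccot ((y * d12 + z * (d12 + d31 - d23) / 2) / (z * D))"
    "angle W P2 P3 = arccot ((z * d23 + x * (d23 + d12 - d31) / 2) / (x * D))"
    "angle W P3 P1 = arccot ((x * d31 + y * (d31 + d23 - d12) / 2) / (y * D))"
    if "0 < x" "0 < y" "0 < z" "x + y + z = 1" "W = x *\<^sub>R P1 + y *\<^sub>R P2 + z *\<^sub>R P3"
    for x y z W
    using that D rot2 rot3
      angle_barycentric[of P2 P1 P3 x y z W]
      angle_barycentric[of P3 P2 P1 y z x W]
      angle_barycentric[of P1 P3 P2 z x y W]
    by (simp_all add: D_def d12_def d23_def d31_def add_ac)
  show ?thesis
  proof
    assume "is_brocard_angle P1 P2 P3 w"
    then obtain x y z W where xyz: "0 < x" "0 < y" "0 < z" "x + y + z = 1"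
        "W = x *\<^sub>R P1 + y *\<^sub>R P2 + z *\<^sub>R P3"
      and w: "angle W P1 P2 = w" "angle W P2 P3 = w" "angle W P3 P1 = w"
      unfolding is_brocard_angle_def interior by auto
    have w_cot: "w = arccot (cot w)"
      using w(1) angles(1)[OF xyz] cot_arccot by metis
    have eqs: "cot w = (y * d12 + z * (d12 + d31 - d23) / 2) / (z * D)"
      "cot w = (z * d23 + x * (d23 + d12 - d31) / 2) / (x * D)"
      "cot w = (x * d31 + y * (d31 + d23 - d12) / 2) / (y * D)"
      using w angles[OF xyz] cot_arccot by metis+
    have nz: "z * D \<noteq> 0" "x * D \<noteq> 0" "y * D \<noteq> 0"
      using xyz D by simp_all
    have "cot w * (z * D) = y * d12 + z * (d12 + d31 - d23) / 2"
      "cot w * (x * D) = z * d23 + x * (d23 + d12 - d31) / 2"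
      "cot w * (y * D) = x * d31 + y * (d31 + d23 - d12) / 2"
      using eqs(1)[unfolded nonzero_eq_divide_eq[OF nz(1)]]
        eqs(2)[unfolded nonzero_eq_divide_eq[OF nz(2)]]
        eqs(3)[unfolded nonzero_eq_divide_eq[OF nz(3)]] .
    \<comment> \<open>In the sum of the right-hand sides every squared side has the coefficient
       \<open>(x + y + z) / 2\<close>.\<close>
    then have "cot w * ((x + y + z) * D) = (x + y + z) * (d12 + d23 + d31) / 2"
      by (simp add: field_simps)
    then have "cot w = brocard_cot P1 P2 P3"
      using D unfolding xyz(4) by (simp add: cot field_simps)
    then show "w = arccot (brocard_cot P1 P2 P3)"
      using w_cot by simp
  next
    assume w: "w = arccot (brocard_cot P1 P2 P3)"
    have "P1 \<noteq> P2" "P2 \<noteq> P3" "P3 \<noteq> P1"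
      using tri by (auto simp: triangle_def insert_commute)
    then have d: "d12 > 0" "d23 > 0" "d31 > 0"
      by (simp_all add: d12_def d23_def d31_def)
    define N where "N = d12 * d23 + d23 * d31 + d31 * d12"
    have N: "N > 0" using d by (simp add: N_def add_pos_pos)
    \<comment> \<open>The solution of \<open>y d12 = z d23 = x d31\<close> normalised to sum 1.\<close>
    define x y z where "x = d12 * d23 / N" and "y = d23 * d31 / N" and "z = d31 * d12 / N"
    define W where "W = x *\<^sub>R P1 + y *\<^sub>R P2 + z *\<^sub>R P3"
    have pos: "0 < x" "0 < y" "0 < z" using d N by (simp_all add: x_def y_def z_def)
    have sum: "x + y + z = 1"
      using N by (simp add: x_def y_def z_def N_def flip: add_divide_distrib)
    have bal: "y * d12 = z * d23" "z * d23 = x * d31" "x * d31 = y * d12"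
      by (simp_all add: x_def y_def z_def)
    have numerators:
      "y * d12 + z * (d12 + d31 - d23) / 2 = z * ((d12 + d23 + d31) / 2)"
      "z * d23 + x * (d23 + d12 - d31) / 2 = x * ((d12 + d23 + d31) / 2)"
      "x * d31 + y * (d31 + d23 - d12) / 2 = y * ((d12 + d23 + d31) / 2)"
      subgoal unfolding bal(1) by (simp add: field_simps)
      subgoal unfolding bal(2) by (simp add: field_simps)
      subgoal unfolding bal(3) by (simp add: field_simps)
      done
    have "angle W P1 P2 = w" "angle W P2 P3 = w" "angle W P3 P1 = w"
      unfolding angles[OF pos sum W_def] numerators w cot
      using pos D by simp_all
    moreover have "W \<in> interior (convex hull {P1, P2, P3})"
      unfolding interior using pos sum W_def by blast
    ultimately show "is_brocard_angle P1 P2 P3 w"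
      unfolding is_brocard_angle_def by blast
  qed
qed

section \<open>Poncelet triangles of the homothetic pair\<close>

text \<open>
  The linear form \<open>v \<mapsto> 2 Q\<^sub>1 v\<^sub>1 / a\<^sup>2 + 2 Q\<^sub>2 v\<^sub>2 / b\<^sup>2\<close> is the derivative at \<open>Q\<close>, and it takes the
  value 2 at \<open>Q\<close> itself.
\<close>

lemma ellipse_tangent_line_eq:
  assumes Q: "Q \<in> ellipse a b"
  shows "ellipse_tangent_line a b Q = {P. Q $ 1 * P $ 1 / a\<^sup>2 + Q $ 2 * P $ 2 / b\<^sup>2 = 1}"
proof -
  have coord: "((\<lambda>P. P $ i) has_derivative (\<lambda>v. v $ i)) (at Q)" for i
    by (rule bounded_linear_imp_has_derivative[OF bounded_linear_vec_nth])
  have square: "((\<lambda>P. (P $ i)\<^sup>2 * c) has_derivative (\<lambda>v. 2 * Q $ i * v $ i * c)) (at Q)" for i c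
    by (rule has_derivative_eq_rhs[OF has_derivative_mult_left[OF has_derivative_power[OF coord]]])
      (simp add: fun_eq_iff)
  have "(ellipse_form a b has_derivative
      (\<lambda>v. 2 * Q $ 1 * v $ 1 / a\<^sup>2 + 2 * Q $ 2 * v $ 2 / b\<^sup>2)) (at Q)"
    unfolding ellipse_form_def[abs_def] divide_inverse
    by (rule has_derivative_add[OF square square])
  then have deriv: "frechet_derivative (ellipse_form a b) (at Q) =
      (\<lambda>v. 2 * Q $ 1 * v $ 1 / a\<^sup>2 + 2 * Q $ 2 * v $ 2 / b\<^sup>2)"
    by (rule frechet_derivative_at[symmetric])
  have at_P: "2 * Q $ 1 * (P - Q) $ 1 / a\<^sup>2 + 2 * Q $ 2 * (P - Q) $ 2 / b\<^sup>2 =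
      2 * (Q $ 1 * P $ 1 / a\<^sup>2 + Q $ 2 * P $ 2 / b\<^sup>2 - 1)" for P
  proof -
    have "2 * Q $ 1 * (P - Q) $ 1 / a\<^sup>2 + 2 * Q $ 2 * (P - Q) $ 2 / b\<^sup>2 =
        2 * (Q $ 1 * P $ 1 / a\<^sup>2 + Q $ 2 * P $ 2 / b\<^sup>2 - ellipse_form a b Q)"
      by (simp add: ellipse_form_def power2_eq_square algebra_simps diff_divide_distrib)
    then show ?thesis using Q by (simp only: ellipse_def mem_Collect_eq)
  qed
  show ?thesis
    unfolding ellipse_tangent_line_def deriv at_P by auto
qed

definition circle_coords :: "real \<Rightarrow> real \<Rightarrow> real^2 \<Rightarrow> real^2" where
  "circle_coords a b P = vector [P $ 1 / a, P $ 2 / b]"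

lemma inner_circle_coords:
  "circle_coords a b P \<bullet> circle_coords a b R = P $ 1 * R $ 1 / a\<^sup>2 + P $ 2 * R $ 2 / b\<^sup>2"
  by (simp add: circle_coords_def inner_vec_def sum_2 power2_eq_square)

lemma inj_circle_coords: "a > 0 \<Longrightarrow> b > 0 \<Longrightarrow> inj (circle_coords a b)"
  by (auto simp: inj_def circle_coords_def vec_eq_iff forall_2)

text \<open>
  For a unit vector \<open>q\<close>, this expresses the scalar product in the orthonormal basis consisting of
  \<open>q\<close> and its rotation by a right angle.
\<close>

lemma inner_mult_inner_self:
  "(u \<bullet> v) * (q \<bullet> q) = (q \<bullet> u) * (q \<bullet> v) + cross2 q u * cross2 q v"
  by (simp add: cross2_def inner_vec_def sum_2 algebra_simps)

text \<open>
  Here \<open>q / 2\<close> is the point of tangency.  Both ends of the chord have component \<open>1/2\<close> along \<open>q\<close>, hence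
  \<open>\<plusminus> sqrt 3 / 2\<close> across it.  As they are different, the signs are opposite.
\<close>

lemma unit_circle_tangent_chord:
  fixes u v q :: "real^2"
  assumes unit: "u \<bullet> u = 1" "v \<bullet> v = 1" "q \<bullet> q = 1"
    and tangent: "q \<bullet> u = 1/2" "q \<bullet> v = 1/2" and "u \<noteq> v"
  shows "u \<bullet> v = -1/2"
proof -
  have cu: "(cross2 q u)\<^sup>2 = 3/4" and cv: "(cross2 q v)\<^sup>2 = 3/4"
    using inner_mult_inner_self[of u u q] inner_mult_inner_self[of v v q] unit tangent
    by (simp_all add: power2_eq_square)
  have "cross2 q u \<noteq> cross2 q v"
  proof
    assume "cross2 q u = cross2 q v"
    then have "cross2 q (u - v) = 0" by (simp add: cross2_def algebra_simps)
    moreover have "q \<bullet> (u - v) = 0" using tangent by (simp add: inner_diff_right)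
    ultimately have "(u - v) \<bullet> (u - v) = 0"
      using inner_mult_inner_self[of "u - v" "u - v" q] unit(3) by simp
    then show False using \<open>u \<noteq> v\<close> by simp
  qed
  then have "cross2 q v = - cross2 q u"
    using cu cv by (metis power2_eq_iff)
  then have "u \<bullet> v = 1/4 - (cross2 q u)\<^sup>2"
    using inner_mult_inner_self[of u v q] unit tangent by (simp add: power2_eq_square)
  then show ?thesis using cu by simp
qed

lemma inner_circle_coords_tangent_chord:
  assumes ab: "a > 0" "b > 0" and P: "P \<in> ellipse a b" "R \<in> ellipse a b" "P \<noteq> R"
    and tangent: "tangent_to_ellipse (a / 2) (b / 2) (affine hull {P, R})"
  shows "circle_coords a b P \<bullet> circle_coords a b R = -1/2"
proof -
  obtain Q where Q: "Q \<in> ellipse (a / 2) (b / 2)"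
    and "affine hull {P, R} = ellipse_tangent_line (a / 2) (b / 2) Q"
    using tangent by (auto simp: tangent_to_ellipse_def)
  then have line: "affine hull {P, R} =
      {X. Q $ 1 * X $ 1 / (a / 2)\<^sup>2 + Q $ 2 * X $ 2 / (b / 2)\<^sup>2 = 1}"
    using ellipse_tangent_line_eq[OF Q] by simp
  define q where "q = 2 *\<^sub>R circle_coords a b Q"
  have "q \<bullet> q = 1"
    using Q by (simp add: q_def inner_circle_coords ellipse_def ellipse_form_def
        power_divide power2_eq_square algebra_simps)
  moreover have on_line: "q \<bullet> circle_coords a b X = 1/2" if "X \<in> affine hull {P, R}" for X
    using that unfolding line by (simp add: q_def inner_circle_coords power_divide algebra_simps)
  have "q \<bullet> circle_coords a b P = 1/2" "q \<bullet> circle_coords a b R = 1/2"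
    by (simp_all add: on_line hull_inc)
  moreover have "circle_coords a b P \<bullet> circle_coords a b P = 1"
    "circle_coords a b R \<bullet> circle_coords a b R = 1"
    using P by (simp_all add: inner_circle_coords ellipse_def ellipse_form_def power2_eq_square)
  moreover have "circle_coords a b P \<noteq> circle_coords a b R"
    using inj_circle_coords[OF ab] P(3) by (auto dest: injD)
  ultimately show ?thesis
    by (intro unit_circle_tangent_chord[of _ _ q]) auto
qed

text \<open>
  Unit vectors with these scalar products have sum \<open>0\<close>, and \<open>v\<close> is \<open>u\<close> rotated by \<open>\<plusminus>2\<pi>/3\<close>.  The
  coordinate sum is the squared length of an orthogonal projection onto an axis, summed over the
  sides; the threefold symmetry makes it independent of the axis, hence half the sum \<open>9\<close> of the
  squared sides.
\<close>

lemma equilateral_coordinate_sums: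
  fixes u v w :: "real^2"
  assumes unit: "u \<bullet> u = 1" "v \<bullet> v = 1" "w \<bullet> w = 1"
    and inner: "u \<bullet> v = -1/2" "v \<bullet> w = -1/2" "w \<bullet> u = -1/2"
  shows "(u $ i - v $ i)\<^sup>2 + (v $ i - w $ i)\<^sup>2 + (w $ i - u $ i)\<^sup>2 = 9/2"
    and "\<bar>cross2 (v - u) (w - u)\<bar> = 3 * sqrt 3 / 2"
proof -
  have "(u + v + w) \<bullet> (u + v + w) = 0"
    using unit inner by (simp add: inner_add inner_commute)
  then have "u + v + w = 0" by simp
  then have w: "w = - u - v" by (simp add: algebra_simps add_eq_0_iff)
  define c where "c = cross2 u v"
  have c2: "c\<^sup>2 = 3/4"
    using inner_mult_inner_self[of v v u] unit inner by (simp add: c_def power2_eq_square)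
  \<comment> \<open>\<open>c\<close> is the sine of the oriented angle from \<open>u\<close> to \<open>v\<close>; the cosine is \<open>-1/2\<close>.\<close>
  have v1: "v $ 1 = - u $ 1 / 2 - c * u $ 2" and v2: "v $ 2 = - u $ 2 / 2 + c * u $ 1"
  proof -
    have uu: "u $ 1 * u $ 1 + u $ 2 * u $ 2 = 1" using unit(1) by (simp add: inner_vec_def sum_2)
    have uv: "u $ 1 * v $ 1 + u $ 2 * v $ 2 = -1/2" using inner(1) by (simp add: inner_vec_def sum_2)
    show "v $ 1 = - u $ 1 / 2 - c * u $ 2" "v $ 2 = - u $ 2 / 2 + c * u $ 1"
      unfolding c_def cross2_def using uu uv by algebra+
  qed
  have uu: "(u $ 1)\<^sup>2 + (u $ 2)\<^sup>2 = 1"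
    using unit(1) by (simp add: inner_vec_def sum_2 power2_eq_square)
  have "(u $ 1 - v $ 1)\<^sup>2 + (v $ 1 - w $ 1)\<^sup>2 + (w $ 1 - u $ 1)\<^sup>2 = 9/2"
    "(u $ 2 - v $ 2)\<^sup>2 + (v $ 2 - w $ 2)\<^sup>2 + (w $ 2 - u $ 2)\<^sup>2 = 9/2"
    unfolding w vector_minus_component vector_uminus_component v1 v2 using uu c2 by algebra+
  then show "(u $ i - v $ i)\<^sup>2 + (v $ i - w $ i)\<^sup>2 + (w $ i - u $ i)\<^sup>2 = 9/2"
    using exhaust_2[of i] by auto
  have "cross2 (v - u) (w - u) = 3 * c"
    by (simp add: w c_def cross2_def algebra_simps)
  moreover have "\<bar>c\<bar> = sqrt 3 / 2"
    using arg_cong[OF c2, of sqrt] by (simp add: real_sqrt_divide)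
  ultimately show "\<bar>cross2 (v - u) (w - u)\<bar> = 3 * sqrt 3 / 2"
    by (simp add: abs_mult)
qed

lemma brocard_cot_homothetic_3_periodic:
  assumes ab: "a > 0" "b > 0" and per: "homothetic_3_periodic a b P1 P2 P3"
  shows "brocard_cot P1 P2 P3 = sqrt 3 * (a\<^sup>2 + b\<^sup>2) / (2 * a * b)"
proof -
  define u v w where "u = circle_coords a b P1" and "v = circle_coords a b P2"
    and "w = circle_coords a b P3"
  have on: "P1 \<in> ellipse a b" "P2 \<in> ellipse a b" "P3 \<in> ellipse a b"
    and tangent: "tangent_to_ellipse (a / 2) (b / 2) (affine hull {P1, P2})"
      "tangent_to_ellipse (a / 2) (b / 2) (affine hull {P2, P3})"
      "tangent_to_ellipse (a / 2) (b / 2) (affine hull {P3, P1})"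
    using per by (auto simp: homothetic_3_periodic_def inscribed_in_ellipse_def
        circumscribed_about_ellipse_def)
  have neq: "P1 \<noteq> P2" "P2 \<noteq> P3" "P3 \<noteq> P1"
    using per by (auto simp: homothetic_3_periodic_def triangle_def insert_commute)
  have unit: "u \<bullet> u = 1" "v \<bullet> v = 1" "w \<bullet> w = 1"
    using on by (simp_all add: u_def v_def w_def inner_circle_coords ellipse_def
        ellipse_form_def power2_eq_square)
  have inner: "u \<bullet> v = -1/2" "v \<bullet> w = -1/2" "w \<bullet> u = -1/2"
    unfolding u_def v_def w_def
    using inner_circle_coords_tangent_chord[OF ab] on tangent neq by blast+
  note equilateral = equilateral_coordinate_sums[OF unit inner]
  have coords: "P1 $ 1 = a * u $ 1" "P1 $ 2 = b * u $ 2" "P2 $ 1 = a * v $ 1"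
    "P2 $ 2 = b * v $ 2" "P3 $ 1 = a * w $ 1" "P3 $ 2 = b * w $ 2"
    using ab by (simp_all add: u_def v_def w_def circle_coords_def)
  have "(norm (P1 - P2))\<^sup>2 + (norm (P2 - P3))\<^sup>2 + (norm (P3 - P1))\<^sup>2 =
      a\<^sup>2 * ((u $ 1 - v $ 1)\<^sup>2 + (v $ 1 - w $ 1)\<^sup>2 + (w $ 1 - u $ 1)\<^sup>2) +
      b\<^sup>2 * ((u $ 2 - v $ 2)\<^sup>2 + (v $ 2 - w $ 2)\<^sup>2 + (w $ 2 - u $ 2)\<^sup>2)"
    unfolding power2_norm_eq_inner inner_vec_def sum_2 vector_minus_component coords
      inner_real_def by algebra
  also have "\<dots> = 9/2 * (a\<^sup>2 + b\<^sup>2)"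
    unfolding equilateral by simp
  finally have sides: "(norm (P1 - P2))\<^sup>2 + (norm (P2 - P3))\<^sup>2 + (norm (P3 - P1))\<^sup>2 =
    9/2 * (a\<^sup>2 + b\<^sup>2)" .
  have "cross2 (P2 - P1) (P3 - P1) = a * b * cross2 (v - u) (w - u)"
    unfolding cross2_def vector_minus_component coords by algebra
  then have area: "\<bar>cross2 (P2 - P1) (P3 - P1)\<bar> = a * b * (3 * sqrt 3 / 2)"
    using ab by (simp add: abs_mult equilateral)
  have "9/2 * (a\<^sup>2 + b\<^sup>2) / (2 * (a * b * (3 * sqrt 3 / 2)))
      = sqrt 3 * (a\<^sup>2 + b\<^sup>2) / (2 * a * b)"
  proof -
    have "sqrt 3 * (a\<^sup>2 + b\<^sup>2) * (6 * sqrt 3) = 6 * (sqrt 3)\<^sup>2 * (a\<^sup>2 + b\<^sup>2)"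
      by (simp only: power2_eq_square mult_ac)
    then have "18 * a\<^sup>2 + 18 * b\<^sup>2 = sqrt 3 * (a\<^sup>2 + b\<^sup>2) * (6 * sqrt 3)"
      by simp
    then show ?thesis using ab by (simp add: divide_simps)
  qed
  then show ?thesis
    by (simp only: brocard_cot_def sides area)
qed

theorem theorem1:
  fixes a b :: real
  assumes "a > 0" and "b > 0"
  shows "\<exists>\<omega>::real.
           (\<forall>P1 P2 P3 :: real^2. homothetic_3_periodic a b P1 P2 P3 \<longrightarrow>
              (\<exists>!w. is_brocard_angle P1 P2 P3 w) \<and> brocard_angle P1 P2 P3 = \<omega>) \<and>
           cot \<omega> = sqrt 3 * (a\<^sup>2 + b\<^sup>2) / (2 * a * b)"
proof (intro exI conjI allI impI)
  let ?\<omega> = "arccot (sqrt 3 * (a\<^sup>2 + b\<^sup>2) / (2 * a * b))"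
  show "cot ?\<omega> = sqrt 3 * (a\<^sup>2 + b\<^sup>2) / (2 * a * b)"
    by (rule cot_arccot)
  fix P1 P2 P3
  assume per: "homothetic_3_periodic a b P1 P2 P3"
  then have "is_brocard_angle P1 P2 P3 w \<longleftrightarrow> w = ?\<omega>" for w
    using is_brocard_angle_iff[of P1 P2 P3] brocard_cot_homothetic_3_periodic[OF assms per]
    by (simp add: homothetic_3_periodic_def)
  then show "\<exists>!w. is_brocard_angle P1 P2 P3 w" "brocard_angle P1 P2 P3 = ?\<omega>"
    by (auto simp: brocard_angle_def)
qed

end
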